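(* Suppose that the lower level solution set mapping $S$ is fixed on $X\cap\operatorname{dom}(U\cap K)$, i.e. $S(x)=S(x')$ for all $x,x'\in X\cap\operatorname{dom}(U\cap K)$. Then: (i) if $(x^*,y^*,w^* )$ is an equilibrium of the generalized Nash equilibrium problem (GNEP), then $(x^*,y^* )$ is a global solution of the standard optimistic bilevel problem (SBP); (ii) if $(x^*,y^* )$ is a global solution of the SBP, then, for all $w^*\in U$ such that $g(x^*,w^* )\le 0$ and $f(x^*,w^* )=f(x^*,y^* )$, the triple $(x^*,y^*,w^* )$ is a solution (equilibrium) of the GNEP.
   Context: Data and standing assumptions: $F,f:\mathbb{R}^{n_1}\times\mathbb{R}^{n_2}\to\mathbb{R}$ and $g:\mathbb{R}^{n_1}\times\mathbb{R}^{n_2}\to\mathbb{R}^m$ are continuous; $X\subseteq\mathbb{R}^{n_1}$ and $U\subseteq\mathbb{R}^{n_2}$ are closed. Vector inequalities are componentwise. Let $K(x):=\{v\in\mathbb{R}^{n_2}: g(x,v)\le 0\}$, $\operatorname{dom}(U\cap K):=\{x\in\mathbb{R}^{n_1}: U\cap K(x)\ne\emptyset\}$, and let $S(x)$ be the set of global minimizers of $w\mapsto f(x,w)$ over $w\in U\cap K(x)$ (empty if there are none). SBP: minimize $F(x,y)$ over $(x,y)\in W$, where $W:=\{(x,y): x\in X,\ y\in S(x)\}$. A global solution of the SBP is a point $(x^*,y^* )\in W$ with $F(x^*,y^* )\le F(x,y)$ for all $(x,y)\in W$. GNEP: a two-player game in which the leader controls $(x,y)$ and minimizes $F(x,y)$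 subject to $(x,y)\in X\times U$, $f(x,y)\le f(x,w)$, $g(x,y)\le 0$, while the follower controls $w$ and minimizes $f(x,w)$ subject to $w\in U$, $g(x,w)\le 0$. For $w\in\mathbb{R}^{n_2}$ put $V(w):=\{(u,v)\in X\times U: f(u,v)\le f(u,w),\ g(u,v)\le 0\}$. An equilibrium (solution) of the GNEP is a triple $(x^*,y^*,w^* )$ such that $(x^*,y^* )\in V(w^* )$; $F(x^*,y^* )\le F(x,y)$ for all $(x,y)\in V(w^* )$; $w^*\in U\cap K(x^* )$; and $f(x^*,w^* )\le f(x^*,w)$ for all $w\in U\cap K(x^* )$. *)

theory Defs
  imports "HOL-Analysis.Analysis"
begin

text \<open>
  The order on \<^typ>\<open>real ^ 'm\<close> is the library's componentwise order, so \<open>g (x, v) \<le> 0\<close> below is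
  the componentwise vector inequality.
\<close>

definition feasible_map ::
    "((real ^ 'n1) \<times> (real ^ 'n2) \<Rightarrow> real ^ 'm) \<Rightarrow> real ^ 'n1 \<Rightarrow> (real ^ 'n2) set" where
  "feasible_map g x = {v. g (x, v) \<le> 0}"

definition lower_dom ::
    "(real ^ 'n2) set \<Rightarrow> ((real ^ 'n1) \<times> (real ^ 'n2) \<Rightarrow> real ^ 'm) \<Rightarrow> (real ^ 'n1) set" where
  "lower_dom U g = {x. U \<inter> feasible_map g x \<noteq> {}}"

definition lower_solutions ::
    "((real ^ 'n1) \<times> (real ^ 'n2) \<Rightarrow> real) \<Rightarrow> ((real ^ 'n1) \<times> (real ^ 'n2) \<Rightarrow> real ^ 'm) \<Rightarrow>
     (real ^ 'n2) set \<Rightarrow> real ^ 'n1 \<Rightarrow> (real ^ 'n2) set" where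
  "lower_solutions f g U x =
     {y \<in> U \<inter> feasible_map g x. \<forall>w \<in> U \<inter> feasible_map g x. f (x, y) \<le> f (x, w)}"

definition SBP_feasible ::
    "((real ^ 'n1) \<times> (real ^ 'n2) \<Rightarrow> real) \<Rightarrow> ((real ^ 'n1) \<times> (real ^ 'n2) \<Rightarrow> real ^ 'm) \<Rightarrow>
     (real ^ 'n1) set \<Rightarrow> (real ^ 'n2) set \<Rightarrow> ((real ^ 'n1) \<times> (real ^ 'n2)) set" where
  "SBP_feasible f g X U = {(x, y). x \<in> X \<and> y \<in> lower_solutions f g U x}"

definition SBP_global_solution ::
    "((real ^ 'n1) \<times> (real ^ 'n2) \<Rightarrow> real) \<Rightarrow> ((real ^ 'n1) \<times> (real ^ 'n2) \<Rightarrow> real) \<Rightarrow>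
     ((real ^ 'n1) \<times> (real ^ 'n2) \<Rightarrow> real ^ 'm) \<Rightarrow> (real ^ 'n1) set \<Rightarrow> (real ^ 'n2) set \<Rightarrow>
     (real ^ 'n1) \<times> (real ^ 'n2) \<Rightarrow> bool" where
  "SBP_global_solution F f g X U p \<longleftrightarrow>
     p \<in> SBP_feasible f g X U \<and> (\<forall>q \<in> SBP_feasible f g X U. F p \<le> F q)"

text \<open>The leader's feasible set in the GNEP, parametrised by the follower's decision \<open>w\<close>.\<close>

definition leader_feasible ::
    "((real ^ 'n1) \<times> (real ^ 'n2) \<Rightarrow> real) \<Rightarrow> ((real ^ 'n1) \<times> (real ^ 'n2) \<Rightarrow> real ^ 'm) \<Rightarrow>
     (real ^ 'n1) set \<Rightarrow> (real ^ 'n2) set \<Rightarrow> real ^ 'n2 \<Rightarrow> ((real ^ 'n1) \<times> (real ^ 'n2)) set" where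
  "leader_feasible f g X U w =
     {(u, v). (u, v) \<in> X \<times> U \<and> f (u, v) \<le> f (u, w) \<and> g (u, v) \<le> 0}"

definition GNEP_equilibrium ::
    "((real ^ 'n1) \<times> (real ^ 'n2) \<Rightarrow> real) \<Rightarrow> ((real ^ 'n1) \<times> (real ^ 'n2) \<Rightarrow> real) \<Rightarrow>
     ((real ^ 'n1) \<times> (real ^ 'n2) \<Rightarrow> real ^ 'm) \<Rightarrow> (real ^ 'n1) set \<Rightarrow> (real ^ 'n2) set \<Rightarrow>
     real ^ 'n1 \<Rightarrow> real ^ 'n2 \<Rightarrow> real ^ 'n2 \<Rightarrow> bool" where
  "GNEP_equilibrium F f g X U x y w \<longleftrightarrow>
     (x, y) \<in> leader_feasible f g X U w \<and>
     (\<forall>(u, v) \<in> leader_feasible f g X U w. F (x, y) \<le> F (u, v)) \<and>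
     w \<in> U \<inter> feasible_map g x \<and>
     (\<forall>w' \<in> U \<inter> feasible_map g x. f (x, w) \<le> f (x, w'))"

end

theory Submission
  imports Defs
begin

text \<open>
  For \<open>w \<in> S(x)\<close> with \<open>x \<in> X\<close>, fixedness of \<open>S\<close> makes \<open>w\<close> a lower-level minimizer at every
  \<open>u \<in> X\<close> whose lower level is feasible. Hence \<open>f(u, v) \<le> f(u, w)\<close> forces \<open>v \<in> S(u)\<close>, and the
  leader's feasible set \<open>V(w)\<close> coincides with \<open>W\<close>: both problems minimize \<open>F\<close> over the same set.
\<close>

lemma lower_solutions_iff:
  "y \<in> lower_solutions f g U x \<longleftrightarrow>
     y \<in> U \<and> g (x, y) \<le> 0 \<and> (\<forall>w \<in> U. g (x, w) \<le> 0 \<longrightarrow> f (x, y) \<le> f (x, w))"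
  by (auto simp: lower_solutions_def feasible_map_def)

text \<open>By transitivity, doing no worse than one known minimizer is enough. This trades the
  quantified optimality condition for the single inequality that defines the leader's
  constraint.\<close>

lemma lower_solutions_le:
  assumes "w \<in> lower_solutions f g U x"
  shows "y \<in> lower_solutions f g U x \<longleftrightarrow> y \<in> U \<and> g (x, y) \<le> 0 \<and> f (x, y) \<le> f (x, w)"
  using assms by (meson lower_solutions_iff order_trans)

lemma lower_dom_iff: "x \<in> lower_dom U g \<longleftrightarrow> (\<exists>v \<in> U. g (x, v) \<le> 0)"
  by (auto simp: lower_dom_def feasible_map_def)

lemma leader_feasible_eq_SBP_feasible:
  assumes S_fixed: "\<forall>x \<in> X \<inter> lower_dom U g. \<forall>x' \<in> X \<inter> lower_dom U g.
           lower_solutions f g U x = lower_solutions f g U x'"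
    and "x \<in> X" and w: "w \<in> lower_solutions f g U x"
  shows "leader_feasible f g X U w = SBP_feasible f g X U"
proof -
  have "x \<in> lower_dom U g"
    using w by (auto simp: lower_dom_iff lower_solutions_iff)
  \<comment> \<open>The point \<open>v\<close> serves only as a witness that \<open>u\<close> lies
    in \<open>lower_dom U g\<close>, where \<open>S_fixed\<close> transfers minimality of
    \<open>w\<close> from \<open>x\<close> to \<open>u\<close>.\<close>
  then have w': "w \<in> lower_solutions f g U u" if "u \<in> X" "v \<in> U" "g (u, v) \<le> 0" for u v
    using assms that lower_dom_iff by blast
  have "(u, v) \<in> leader_feasible f g X U w \<longleftrightarrow> (u, v) \<in> SBP_feasible f g X U" for u v
  proof (cases "u \<in> X \<and> v \<in> U \<and> g (u, v) \<le> 0")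
    case True
    then show ?thesis
      using lower_solutions_le[OF w'[of u v]] by (simp add: leader_feasible_def SBP_feasible_def)
  next
    \<comment> \<open>Both sets impose the condition negated here, so neither contains
      \<open>(u, v)\<close>.\<close>
    case False
    then show ?thesis
      by (auto simp: leader_feasible_def SBP_feasible_def lower_solutions_iff)
  qed
  then show ?thesis
    by auto
qed

text \<open>The follower's conditions amount to \<open>w\<close> being a lower-level minimizer at
  \<open>x\<close>, which is what the equality of the two feasible sets requires.\<close>

lemma GNEP_equilibrium_iff:
  "GNEP_equilibrium F f g X U x y w \<longleftrightarrow>
     w \<in> lower_solutions f g U x \<and> (x, y) \<in> leader_feasible f g X U w \<and>
     (\<forall>q \<in> leader_feasible f g X U w. F (x, y) \<le> F q)"
  by (auto simp: GNEP_equilibrium_def lower_solutions_def)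

theorem theorem3p8:
  fixes F f :: "(real ^ 'n1) \<times> (real ^ 'n2) \<Rightarrow> real"
    and g :: "(real ^ 'n1) \<times> (real ^ 'n2) \<Rightarrow> real ^ 'm"
    and X :: "(real ^ 'n1) set"
    and U :: "(real ^ 'n2) set"
  assumes "continuous_on UNIV F"
    and "continuous_on UNIV f"
    and "continuous_on UNIV g"
    and "closed X"
    and "closed U"
    and S_fixed: "\<forall>x \<in> X \<inter> lower_dom U g. \<forall>x' \<in> X \<inter> lower_dom U g.
           lower_solutions f g U x = lower_solutions f g U x'"
  shows "(\<forall>xs ys ws. GNEP_equilibrium F f g X U xs ys ws \<longrightarrow>
            SBP_global_solution F f g X U (xs, ys)) \<and>
         (\<forall>xs ys. SBP_global_solution F f g X U (xs, ys) \<longrightarrow>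
            (\<forall>ws \<in> U. g (xs, ws) \<le> 0 \<and> f (xs, ws) = f (xs, ys) \<longrightarrow>
               GNEP_equilibrium F f g X U xs ys ws))"
proof (intro conjI allI ballI impI)
  fix xs ys ws
  assume eq: "GNEP_equilibrium F f g X U xs ys ws"
  then have "xs \<in> X" "ws \<in> lower_solutions f g U xs"
    by (auto simp: GNEP_equilibrium_iff leader_feasible_def)
  from leader_feasible_eq_SBP_feasible[OF S_fixed this] eq
  show "SBP_global_solution F f g X U (xs, ys)"
    by (simp add: GNEP_equilibrium_iff SBP_global_solution_def)
next
  fix xs ys ws
  assume sol: "SBP_global_solution F f g X U (xs, ys)"
    and "ws \<in> U" and "g (xs, ws) \<le> 0 \<and> f (xs, ws) = f (xs, ys)"
  \<comment> \<open>\<open>ws\<close> is feasible and ties with the minimizer \<open>ys\<close> in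
    the value of \<open>f\<close>, so it is a minimizer too.\<close>
  then have "xs \<in> X" and ws: "ws \<in> lower_solutions f g U xs"
    by (auto simp: SBP_global_solution_def SBP_feasible_def lower_solutions_iff)
  from leader_feasible_eq_SBP_feasible[OF S_fixed this] sol ws
  show "GNEP_equilibrium F f g X U xs ys ws"
    by (simp add: GNEP_equilibrium_iff SBP_global_solution_def)
qed

end
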